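(* Let $d\ge 1$ and let $T$ be a random pseudometric over $\mathbb{R}^d$ satisfying: (i) (ergodicity) $T$ is ergodic under the action of the translations of $\mathbb{R}^d$; (ii) (finite moment) for every $x\in\mathbb{R}^d$, $\mathbb{E}(T(0,x))<\infty$. Then there exists a (deterministic) $\mathbb{Q}$-semi-norm $\mu:\mathbb{R}^d\to\mathbb{R}_+$ such that $$\forall v\in\mathbb{R}^d,\quad \lim_{n\to+\infty}\frac1n T(0,nv)=\mu(v)\quad\text{almost surely and in } L^1 .$$ If moreover $T$ is isotropic, i.e. the law of $T$ is invariant under the action of the orthogonal group of $\mathbb{R}^d$, then $\mu$ is constant over the unit sphere $\mathbb{S}^{d-1}$.
   Context: A pseudometric on $\mathbb{R}^d$ is a map $T:(\mathbb{R}^d)^2\to\mathbb{R}_+$ satisfying all the axioms of a metric except possibly non-degeneracy ($T(x,y)=0$ is allowed for $x\neq y$). A random pseudometric is a random variable with values in the set of pseudometrics on $\mathbb{R}^d$, equipped with the $\sigma$-algebra generated by the evaluations $T\mapsto T(x,y)$. Translations act on pseudometrics by $\tau_v(T)(x,y)=T(v+x,v+y)$, and orthogonal maps $O$ act by $(x,y)\mapsto T(Ox,Oy)$. The action $\tau_v$ is ergodic for the law of $T$ if the law is invariant under $\tau_v$ and every $\tau_v$-invariant event has probability $0$ or $1$. $T$ is ergodic under the translations if $\tau_v$ is ergodic for the law of $T$ for every $v\in\mathbb{R}^d\setminus\{0\}$. A $\mathbb{Q}$-semi-norm over $\mathbb{R}^d$ is a map $\mu:\mathbb{R}^d\to\mathbb{R}_+$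 with $\mu(\lambda x)=|\lambda|\mu(x)$ for all $\lambda\in\mathbb{Q}$, $x\in\mathbb{R}^d$, and $\mu(x+y)\le\mu(x)+\mu(y)$ for all $x,y\in\mathbb{R}^d$. *)

theory Defs
  imports "HOL-Probability.Probability"
begin

definition pseudometric :: "('a \<Rightarrow> 'a \<Rightarrow> real) \<Rightarrow> bool" where
  "pseudometric T \<longleftrightarrow>
     (\<forall>x y. 0 \<le> T x y) \<and> (\<forall>x. T x x = 0) \<and> (\<forall>x y. T x y = T y x) \<and>
     (\<forall>x y z. T x z \<le> T x y + T y z)"

definition pseudometric_space :: "('a \<Rightarrow> 'a \<Rightarrow> real) measure" where
  "pseudometric_space =
     sigma {T. pseudometric T} {{T. pseudometric T \<and> T x y \<in> B} |x y B. B \<in> sets borel}"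

definition pull_back :: "('a \<Rightarrow> 'a) \<Rightarrow> ('a \<Rightarrow> 'a \<Rightarrow> real) \<Rightarrow> 'a \<Rightarrow> 'a \<Rightarrow> real" where
  "pull_back g T = (\<lambda>x y. T (g x) (g y))"

definition translate :: "'a::plus \<Rightarrow> ('a \<Rightarrow> 'a \<Rightarrow> real) \<Rightarrow> 'a \<Rightarrow> 'a \<Rightarrow> real" where
  "translate v = pull_back (\<lambda>x. v + x)"

lemma space_pseudometric_space [simp]: "space pseudometric_space = {T. pseudometric T}"
  unfolding pseudometric_space_def by (rule space_measure_of) auto

lemma measurable_eval [measurable]:
  "(\<lambda>T. T x y) \<in> borel_measurable pseudometric_space"
proof (rule measurableI)
  fix B :: "real set" assume "B \<in> sets borel"
  then show "(\<lambda>T. T x y) -` B \<inter> space pseudometric_space \<in> sets pseudometric_space"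
    unfolding space_pseudometric_space unfolding pseudometric_space_def
    by (subst sets_measure_of) (auto intro!: sigma_sets.Basic)
qed simp

lemma measurable_pseudometric_spaceI:
  fixes f :: "'w \<Rightarrow> 'a \<Rightarrow> 'a \<Rightarrow> real"
  assumes "\<And>w. w \<in> space M \<Longrightarrow> pseudometric (f w)"
    and "\<And>x y. (\<lambda>w. f w x y) \<in> borel_measurable M"
  shows "f \<in> M \<rightarrow>\<^sub>M pseudometric_space"
  unfolding pseudometric_space_def
proof (rule measurable_measure_of)
  fix A :: "('a \<Rightarrow> 'a \<Rightarrow> real) set"
  assume "A \<in> {{T. pseudometric T \<and> T x y \<in> B} |x y B. B \<in> sets borel}"
  then obtain x y B where A: "A = {T. pseudometric T \<and> T x y \<in> B}" "B \<in> sets borel" by blast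
  have "f -` A \<inter> space M = (\<lambda>w. f w x y) -` B \<inter> space M"
    using assms(1) by (auto simp: A(1))
  then show "f -` A \<inter> space M \<in> sets M"
    using measurable_sets[OF assms(2) A(2)] by simp
qed (use assms(1) in auto)

lemma measurable_pull_back [measurable]:
  "pull_back g \<in> pseudometric_space \<rightarrow>\<^sub>M pseudometric_space"
  by (rule measurable_pseudometric_spaceI) (auto simp: pull_back_def pseudometric_def)

lemma measurable_translate [measurable]:
  "translate v \<in> pseudometric_space \<rightarrow>\<^sub>M pseudometric_space"
  unfolding translate_def by (rule measurable_pull_back)

definition invariant_under :: "('b \<Rightarrow> 'b) \<Rightarrow> 'b measure \<Rightarrow> bool" where
  "invariant_under f N \<longleftrightarrow> f \<in> N \<rightarrow>\<^sub>M N \<and> distr N N f = N"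

text \<open>The \<open>0\<close>-\<open>1\<close> alternative below is meant for probability measures \<open>N\<close>.\<close>

definition ergodic_for :: "('b \<Rightarrow> 'b) \<Rightarrow> 'b measure \<Rightarrow> bool" where
  "ergodic_for f N \<longleftrightarrow> invariant_under f N \<and>
     (\<forall>A\<in>sets N. f -` A \<inter> space N = A \<longrightarrow> measure N A = 0 \<or> measure N A = 1)"

definition law :: "'w measure \<Rightarrow> ('w \<Rightarrow> 'a \<Rightarrow> 'a \<Rightarrow> real) \<Rightarrow> ('a \<Rightarrow> 'a \<Rightarrow> real) measure" where
  "law M T = distr M pseudometric_space T"

definition translation_ergodic ::
    "'w measure \<Rightarrow> ('w \<Rightarrow> 'a::real_vector \<Rightarrow> 'a \<Rightarrow> real) \<Rightarrow> bool" where
  "translation_ergodic M T \<longleftrightarrow> (\<forall>v. v \<noteq> 0 \<longrightarrow> ergodic_for (translate v) (law M T))"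

definition isotropic ::
    "'w measure \<Rightarrow> ('w \<Rightarrow> 'a::real_inner \<Rightarrow> 'a \<Rightarrow> real) \<Rightarrow> bool" where
  "isotropic M T \<longleftrightarrow>
     (\<forall>g. orthogonal_transformation g \<longrightarrow> invariant_under (pull_back g) (law M T))"

definition rat_seminorm :: "('a::real_vector \<Rightarrow> real) \<Rightarrow> bool" where
  "rat_seminorm \<mu> \<longleftrightarrow>
     (\<forall>x. 0 \<le> \<mu> x) \<and>
     (\<forall>q::rat. \<forall>x. \<mu> (of_rat q *\<^sub>R x) = \<bar>of_rat q\<bar> * \<mu> x) \<and>
     (\<forall>x y. \<mu> (x + y) \<le> \<mu> x + \<mu> y)"

end

theory Submission
  imports Defs
begin

text \<open>
  For \<open>v \<noteq> 0\<close> the passage times \<open>g n = T(0, n v)\<close> form a nonnegative subadditive process over the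
  ergodic shift \<open>\<tau>\<^sub>v\<close>, so the limit is given by Kingman's theorem. Its proof follows Katznelson-Weiss
  and Steele: \<open>liminf g n / n\<close> does not decrease along orbits, hence is almost surely constant. If this
  constant is less than \<open>\<beta>\<close>, all points outside a set of small measure admit a jump of bounded length
  and of cost at most \<open>\<beta>\<close> per step, and chaining such jumps gives \<open>E (g n) \<le> (\<beta> + o(1)) n\<close>.
  Applied to the additive processes \<open>\<plusminus>S n\<close> this yields Birkhoff's theorem, which in turn controls the chained inequality pointwise and bounds
  \<open>limsup g n / n\<close>. Fatou's lemma and Scheffe's lemma give the value of the constant and the
  \<open>L\<^sup>1\<close> convergence. The semi-norm is \<open>\<mu> v = lim E (T(0, n v)) / n\<close>, whose properties follow from
  stationarity alone.
\<close>

section \<open>Ergodic maps: iterates and a zero-one law\<close>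

locale ergodic_map = prob_space N for N :: "'b measure" +
  fixes f :: "'b \<Rightarrow> 'b"
  assumes ergodic: "ergodic_for f N"
begin

lemma measurable_f [measurable]: "f \<in> N \<rightarrow>\<^sub>M N"
  and distr_f: "distr N N f = N"
  using ergodic by (auto simp: ergodic_for_def invariant_under_def)

lemma measurable_iterate [measurable]: "f ^^ k \<in> N \<rightarrow>\<^sub>M N"
  by (induction k) auto

lemma iterate_in_space: "x \<in> space N \<Longrightarrow> (f ^^ k) x \<in> space N"
  using measurable_space[OF measurable_iterate] .

lemma distr_iterate: "distr N N (f ^^ k) = N"
proof (induction k)
  case 0
  show ?case by (simp add: id_def distr_id2)
next
  case (Suc k)
  have "distr N N (f ^^ Suc k) = distr (distr N N (f ^^ k)) N f"
    by (simp add: distr_distr comp_def)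
  then show ?case by (simp only: Suc distr_f)
qed

lemma integrable_iterate:
  fixes h :: "'b \<Rightarrow> real"
  assumes "integrable N h"
  shows "integrable N (\<lambda>x. h ((f ^^ k) x))"
proof -
  have "integrable (distr N N (f ^^ k)) h" using assms by (simp add: distr_iterate)
  then show ?thesis using assms by (subst (asm) integrable_distr_eq) auto
qed

lemma expectation_iterate:
  fixes h :: "'b \<Rightarrow> real"
  assumes [measurable]: "h \<in> borel_measurable N"
  shows "expectation (\<lambda>x. h ((f ^^ k) x)) = expectation h"
proof -
  have "expectation (\<lambda>x. h ((f ^^ k) x)) = integral\<^sup>L (distr N N (f ^^ k)) h"
    by (subst integral_distr) auto
  then show ?thesis by (simp add: distr_iterate)
qed

lemma prob_iterate_vimage:
  assumes "A \<in> sets N"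
  shows "prob ((f ^^ n) -` A \<inter> space N) = prob A"
  using measure_distr[OF measurable_iterate assms] distr_iterate by metis

text \<open>The increasing union of the preimages of \<open>A\<close> is strictly invariant and has the measure of \<open>A\<close>.\<close>

lemma zero_one_subinvariant:
  assumes A: "A \<in> sets N" and sub: "\<And>x. x \<in> A \<Longrightarrow> f x \<in> A"
  shows "prob A = 0 \<or> prob A = 1"
proof -
  define B where "B n = (f ^^ n) -` A \<inter> space N" for n
  have B: "B n \<in> sets N" for n
    using A by (auto simp: B_def intro: measurable_sets)
  have inc: "incseq B"
    by (rule incseq_SucI) (auto simp: B_def sub)
  have pB: "prob (B n) = prob A" for n
    by (simp add: B_def prob_iterate_vimage A)
  have "(\<lambda>n. prob (B n)) \<longlonglongrightarrow> prob (\<Union>n. B n)"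
    using B inc by (intro finite_Lim_measure_incseq) auto
  then have U: "prob (\<Union>n. B n) = prob A"
    by (simp add: pB LIMSEQ_const_iff)
  have B_Suc: "f -` B n \<inter> space N = B (Suc n)" for n
    using measurable_space[OF measurable_f]
    by (auto simp: B_def funpow_Suc_right simp del: funpow.simps)
  have "f -` (\<Union>n. B n) \<inter> space N = (\<Union>n. B (Suc n))"
    using B_Suc by auto
  also have "\<dots> = (\<Union>n. B n)"
    using inc by (fastforce dest: incseq_SucD)
  finally have "prob (\<Union>n. B n) = 0 \<or> prob (\<Union>n. B n) = 1"
    using ergodic B by (auto simp: ergodic_for_def)
  then show ?thesis by (simp add: U)
qed

end

section \<open>Subadditive processes: the almost sure lower rate and the covering estimate\<close>

locale subadditive_process = ergodic_map +
  fixes g :: "nat \<Rightarrow> 'a \<Rightarrow> real"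
  assumes integrable_g: "integrable N (g n)"
    and g_0: "x \<in> space N \<Longrightarrow> g 0 x = 0"
    and subadditive: "x \<in> space N \<Longrightarrow> g (m + n) x \<le> g m x + g n ((f ^^ m) x)"
begin

lemma measurable_g [measurable]: "g n \<in> borel_measurable N"
  using integrable_g by auto

text \<open>Extended-valued, since no pointwise bound on \<open>g n x / n\<close> is available in
  advance. The value at \<open>n = 0\<close> does not affect the liminf.\<close>

definition lower_rate :: "'a \<Rightarrow> ereal" where
  "lower_rate x = liminf (\<lambda>n. ereal (g n x / real n))"

text \<open>The points without a cheap jump of bounded length. These sets decrease in
  \<open>K\<close>, and their intersection is null once \<open>lower_rate\<close> is below \<beta>
  almost everywhere.\<close>

definition bad :: "real \<Rightarrow> nat \<Rightarrow> 'a set" where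
  "bad \<beta> K = {x \<in> space N. \<forall>l\<in>{1..K}. \<beta> * real l \<le> g l x}"

text \<open>The absolute value makes the excess nonnegative, so adding further terms only weakens an
  upper bound.\<close>

definition excess :: "real \<Rightarrow> 'a \<Rightarrow> real" where
  "excess \<beta> x = \<bar>g 1 x - \<beta>\<bar>"

definition bad_excess :: "real \<Rightarrow> nat \<Rightarrow> 'a \<Rightarrow> real" where
  "bad_excess \<beta> K x = indicator (bad \<beta> K) x * excess \<beta> x"

lemma measurable_lower_rate [measurable]: "lower_rate \<in> borel_measurable N"
  unfolding lower_rate_def by measurable

lemma sets_bad [measurable]: "bad \<beta> K \<in> sets N"
  unfolding bad_def by measurable

lemma integrable_excess: "integrable N (excess \<beta>)"
  unfolding excess_def using integrable_g by auto

lemma integrable_bad_excess: "integrable N (bad_excess \<beta> K)"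
  unfolding bad_excess_def
  using integrable_real_mult_indicator[OF sets_bad integrable_excess] by (simp add: mult.commute)

lemma excess_nonneg: "0 \<le> excess \<beta> x" and bad_excess_nonneg: "0 \<le> bad_excess \<beta> K x"
  by (auto simp: excess_def bad_excess_def)

text \<open>Advance by \<open>n\<close> single steps, each costing at most \<beta> plus its
  excess.\<close>

lemma le_sum_excess:
  assumes "x \<in> space N"
  shows "g n x \<le> \<beta> * real n + (\<Sum>k<n. excess \<beta> ((f ^^ k) x))"
proof (induction n)
  case 0
  then show ?case using assms by (simp add: g_0)
next
  case (Suc n)
  have "g (n + 1) x \<le> g n x + g 1 ((f ^^ n) x)"
    using assms by (rule subadditive)
  moreover have "g 1 ((f ^^ n) x) \<le> \<beta> + excess \<beta> ((f ^^ n) x)"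
    by (simp add: excess_def)
  ultimately show ?case using Suc by (simp add: algebra_simps)
qed

text \<open>Starting from a point that is not bad, one can jump ahead by at most \<open>K\<close> steps at cost at most
  \<open>\<beta>\<close> per step; at a bad point one makes a single step, and pays the excess.\<close>

lemma covering_inequality:
  assumes "x \<in> space N" "1 \<le> K"
  shows "g n x \<le> \<beta> * real n + (\<Sum>k<n. bad_excess \<beta> K ((f ^^ k) x))
     + (\<Sum>k=n-K..<n. excess \<beta> ((f ^^ k) x))"
  using assms(1)
proof (induction n arbitrary: x rule: less_induct)
  case (less n)
  show ?case
  proof (cases "n \<le> K")
    \<comment> \<open>Truncated subtraction gives \<open>n - K = 0\<close>, so the terminal sum
      covers all \<open>n\<close> steps and single steps suffice.\<close>
    case True
    have "0 \<le> (\<Sum>k<n. bad_excess \<beta> K ((f ^^ k) x))"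
      by (intro sum_nonneg bad_excess_nonneg)
    with True le_sum_excess[OF less.prems, of n \<beta>] show ?thesis
      by (simp add: lessThan_atLeast0)
  next
    case False
    obtain l where l: "1 \<le> l" "l \<le> K"
      "g l x \<le> \<beta> * real l + (\<Sum>k<l. bad_excess \<beta> K ((f ^^ k) x))"
    proof (cases "x \<in> bad \<beta> K")
      case True
      then have "g 1 x \<le> \<beta> * real 1 + (\<Sum>k<1. bad_excess \<beta> K ((f ^^ k) x))"
        by (simp add: bad_excess_def excess_def)
      then show ?thesis using that[of 1] assms(2) by blast
    next
      case False
      then obtain l where l: "l \<in> {1..K}" "g l x < \<beta> * real l"
        using less.prems by (auto simp: bad_def not_le)
      have "0 \<le> (\<Sum>k<l. bad_excess \<beta> K ((f ^^ k) x))"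
        by (intro sum_nonneg bad_excess_nonneg)
      with l show ?thesis using that[of l] by simp
    qed
    have ln: "l < n" using l False by simp
    define y where "y = (f ^^ l) x"
    have fy: "(f ^^ k) y = (f ^^ (k + l)) x" for k
      by (simp add: y_def funpow_add)
    have "g (n - l) y \<le> \<beta> * real (n - l) + (\<Sum>k<n - l. bad_excess \<beta> K ((f ^^ k) y))
        + (\<Sum>k=n-l-K..<n-l. excess \<beta> ((f ^^ k) y))"
      using less.prems l ln by (intro less.IH) (auto simp: y_def iterate_in_space)
    moreover have "(\<Sum>k<n - l. bad_excess \<beta> K ((f ^^ k) y)) = (\<Sum>k=l..<n. bad_excess \<beta> K ((f ^^ k) x))"
      using sum.shift_bounds_nat_ivl[of "\<lambda>k. bad_excess \<beta> K ((f ^^ k) x)" 0 l "n - l"] ln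
      by (simp add: fy lessThan_atLeast0)
    moreover have "(\<Sum>k=n-l-K..<n-l. excess \<beta> ((f ^^ k) y))
        = (\<Sum>k=n-l-K+l..<n. excess \<beta> ((f ^^ k) x))"
      using sum.shift_bounds_nat_ivl[of "\<lambda>k. excess \<beta> ((f ^^ k) x)" "n-l-K" l "n - l"] ln
      by (simp add: fy)
    \<comment> \<open>If \<open>n - l < K\<close>, truncation puts the left start index at
      \<open>l\<close>; in either case it is at least \<open>n - K\<close>.\<close>
    moreover have "(\<Sum>k=n-l-K+l..<n. excess \<beta> ((f ^^ k) x)) \<le> (\<Sum>k=n-K..<n. excess \<beta> ((f ^^ k) x))"
      by (intro sum_mono2) (auto simp: excess_nonneg)
    moreover have "g n x \<le> g l x + g (n - l) y"
      using subadditive[OF less.prems, of l "n - l"] ln by (simp add: y_def)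
    moreover have "(\<Sum>k<n. bad_excess \<beta> K ((f ^^ k) x)) =
       (\<Sum>k<l. bad_excess \<beta> K ((f ^^ k) x)) + (\<Sum>k=l..<n. bad_excess \<beta> K ((f ^^ k) x))"
      using sum.atLeastLessThan_concat[of 0 l n "\<lambda>k. bad_excess \<beta> K ((f ^^ k) x)"] ln
      by (simp add: lessThan_atLeast0)
    moreover have "\<beta> * real n = \<beta> * real l + \<beta> * real (n - l)"
      using ln by (simp add: of_nat_diff algebra_simps)
    ultimately show ?thesis using l(3) by linarith
  qed
qed

text \<open>Integrate the covering inequality: invariance gives all iterates the same expectation,
  and the terminal block has at most \<open>K\<close> terms, so its cost is bounded independently of
  \<open>n\<close>.\<close>

lemma expectation_covering:
  assumes "1 \<le> K"
  shows "expectation (g n) \<le> \<beta> * real n + real n * expectation (bad_excess \<beta> K)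
     + real K * expectation (excess \<beta>)"
proof -
  have [measurable]: "excess \<beta> \<in> borel_measurable N" "bad_excess \<beta> K \<in> borel_measurable N"
    using integrable_excess integrable_bad_excess by auto
  have [simp]: "integrable N (\<lambda>x. excess \<beta> ((f ^^ k) x))"
    "integrable N (\<lambda>x. bad_excess \<beta> K ((f ^^ k) x))" for k
    using integrable_iterate integrable_excess integrable_bad_excess by auto
  have e0: "0 \<le> expectation (excess \<beta>)"
    by (simp add: excess_nonneg)
  have "expectation (g n) \<le> expectation (\<lambda>x. \<beta> * real n + (\<Sum>k<n. bad_excess \<beta> K ((f ^^ k) x))
     + (\<Sum>k=n-K..<n. excess \<beta> ((f ^^ k) x)))"
    using assms by (intro integral_mono integrable_g covering_inequality) auto
  also have "\<dots> = \<beta> * real n + real n * expectation (bad_excess \<beta> K)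
      + real (n - (n - K)) * expectation (excess \<beta>)"
    by (simp add: expectation_iterate prob_space)
  also have "real (n - (n - K)) * expectation (excess \<beta>) \<le> real K * expectation (excess \<beta>)"
    using e0 by (intro mult_right_mono) auto
  finally show ?thesis by simp
qed

text \<open>Subadditivity gives \<open>g (n + 1) x \<le> g 1 x + g n (f x)\<close>, and division by
  \<open>n\<close> removes the first step in the limit. Only this one inequality is available, hence
  the zero-one law for sets mapped into themselves.\<close>

lemma lower_rate_f:
  assumes x: "x \<in> space N"
  shows "lower_rate x \<le> lower_rate (f x)"
  unfolding lower_rate_def le_Liminf_iff
proof (intro allI impI)
  fix y assume y: "y < liminf (\<lambda>n. ereal (g n x / real n))"
  show "\<forall>\<^sub>F n in sequentially. y < ereal (g n (f x) / real n)"
  \<comment> \<open>Infinite \<open>y\<close> is immediate: the bottom value lies below every real,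
    the top value below nothing.\<close>
  proof (cases y)
    case (real r)
    \<comment> \<open>The gap between \<open>y\<close> and \<open>z\<close> absorbs both
      \<open>g 1 x / n\<close> and the factor \<open>(n + 1) / n\<close>.\<close>
    obtain z where z: "y < z" "z < liminf (\<lambda>n. ereal (g n x / real n))"
      using dense[OF y] by blast
    obtain s where s: "z = ereal s" using z real by (cases z) auto
    have rs: "r < s" using z s real by simp
    have "\<forall>\<^sub>F n in sequentially. ereal s < ereal (g n x / real n)"
      using less_LiminfD[OF z(2)] s by simp
    then have 1: "\<forall>\<^sub>F n in sequentially. s < g (Suc n) x / real (Suc n)"
      by (subst eventually_sequentially_Suc) simp
    have "(\<lambda>n. s * (real (Suc n) / real n) - g 1 x / real n) \<longlonglongrightarrow> s * 1 - 0"
      by (intro tendsto_intros LIMSEQ_Suc_n_over_n lim_const_over_n)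
    then have 2: "\<forall>\<^sub>F n in sequentially. r < s * (real (Suc n) / real n) - g 1 x / real n"
      using rs by (intro order_tendstoD) auto
    show ?thesis
      using 1 2 eventually_gt_at_top[of 0]
    proof eventually_elim
      case (elim n)
      have "g (1 + n) x \<le> g 1 x + g n ((f ^^ 1) x)" by (rule subadditive[OF x])
      with elim(1) have "s * real (Suc n) - g 1 x < g n (f x)"
        by (simp add: field_simps)
      then have "(s * real (Suc n) - g 1 x) / real n < g n (f x) / real n"
        using elim(3) by (intro divide_strict_right_mono) auto
      with elim(2) show ?case by (simp add: real diff_divide_distrib)
    qed
  qed (use y in auto)
qed

text \<open>By \<open>lower_rate_f\<close> the superlevel set is mapped into itself, so the zero-one
  law applies.\<close>

lemma lower_rate_dichotomy: "(AE x in N. c \<le> lower_rate x) \<or> (AE x in N. lower_rate x < c)"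
proof -
  define A where "A = {x \<in> space N. c \<le> lower_rate x}"
  have A: "A \<in> sets N" unfolding A_def by measurable
  have "prob A = 0 \<or> prob A = 1"
    using lower_rate_f measurable_space[OF measurable_f]
    by (intro zero_one_subinvariant A) (auto simp: A_def intro: order_trans)
  moreover have "(AE x in N. x \<notin> A) \<longleftrightarrow> (AE x in N. lower_rate x < c)"
    by (rule AE_cong) (auto simp: A_def)
  moreover have "(AE x in N. x \<in> A) \<longleftrightarrow> (AE x in N. c \<le> lower_rate x)"
    by (rule AE_cong) (auto simp: A_def)
  ultimately show ?thesis
    using prob_eq_0[OF A] prob_eq_1[OF A] by metis
qed

text \<open>Dominated convergence with bound \<open>excess \<beta>\<close>: a lower rate below
  \<beta> supplies a cheap jump of some length \<open>l\<close>, and the point is not bad for any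
  \<open>K \<ge> l\<close>.\<close>

lemma expectation_bad_excess_tendsto_0:
  assumes "AE x in N. lower_rate x < ereal \<beta>"
  shows "(\<lambda>K. expectation (bad_excess \<beta> K)) \<longlonglongrightarrow> 0"
proof -
  have [measurable]: "excess \<beta> \<in> borel_measurable N" "bad_excess \<beta> K \<in> borel_measurable N" for K
    using integrable_excess integrable_bad_excess by auto
  have "(\<lambda>K. expectation (bad_excess \<beta> K)) \<longlonglongrightarrow> expectation (\<lambda>x. 0)"
  proof (rule integral_dominated_convergence[where w = "excess \<beta>"])
    show "AE x in N. (\<lambda>K. bad_excess \<beta> K x) \<longlonglongrightarrow> 0"
      using assms
    proof eventually_elim
      case (elim x)
      have "\<not> (\<forall>\<^sub>F n in sequentially. ereal \<beta> \<le> ereal (g n x / real n))"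
        using elim Liminf_bounded[of "ereal \<beta>" "\<lambda>n. ereal (g n x / real n)" sequentially]
        by (auto simp: lower_rate_def)
      then have "\<exists>\<^sub>F n in sequentially. g n x / real n < \<beta>"
        by (simp add: frequently_def not_less)
      \<comment> \<open>Asking for \<open>1 \<le> l\<close> discards \<open>n = 0\<close>, where the
        quotient is 0 by convention.\<close>
      then obtain l where l: "1 \<le> l" "g l x / real l < \<beta>"
        by (auto simp: frequently_sequentially)
      have "\<forall>\<^sub>F K in sequentially. bad_excess \<beta> K x = 0"
        using eventually_ge_at_top[of l]
      proof eventually_elim
        case (elim K)
        then have "x \<notin> bad \<beta> K" using l by (auto simp: bad_def field_simps intro!: bexI[of _ l])
        then show ?case by (simp add: bad_excess_def)
      qed
      then show ?case by (rule tendsto_eventually)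
    qed
  qed (auto simp: integrable_excess bad_excess_def excess_nonneg indicator_def)
  then show ?thesis by simp
qed

lemma small_bad_excess:
  assumes "AE x in N. lower_rate x < ereal \<beta>" "0 < \<epsilon>"
  obtains K where "1 \<le> K" "expectation (bad_excess \<beta> K) < \<epsilon>"
proof -
  have "\<forall>\<^sub>F K in sequentially. expectation (bad_excess \<beta> K) < \<epsilon>"
    using assms by (intro order_tendstoD[OF expectation_bad_excess_tendsto_0])
  then show ?thesis
    using that eventually_happens'[OF _ eventually_conj[OF eventually_ge_at_top]]
    by (metis trivial_limit_sequentially)
qed

text \<open>Fix \<open>K\<close> so that the bad points cost less than
  \<open>\<beta>' - \<beta>\<close> per step; the terminal block then vanishes after division by
  \<open>n\<close>.\<close>

lemma expectation_eventually_less: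
  assumes "AE x in N. lower_rate x < ereal \<beta>" "\<beta> < \<beta>'"
  shows "\<forall>\<^sub>F n in sequentially. expectation (g n) / real n < \<beta>'"
proof -
  obtain K where K: "1 \<le> K" "expectation (bad_excess \<beta> K) < \<beta>' - \<beta>"
    using small_bad_excess[OF assms(1), of "\<beta>' - \<beta>"] assms(2) by auto
  have "(\<lambda>n. \<beta> + expectation (bad_excess \<beta> K) + real K * expectation (excess \<beta>) / real n)
     \<longlonglongrightarrow> \<beta> + expectation (bad_excess \<beta> K) + 0"
    by (intro tendsto_intros lim_const_over_n)
  then have "\<forall>\<^sub>F n in sequentially.
      \<beta> + expectation (bad_excess \<beta> K) + real K * expectation (excess \<beta>) / real n < \<beta>'"
    using K by (intro order_tendstoD) auto
  then show ?thesis using eventually_gt_at_top[of 0]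
  proof eventually_elim
    case (elim n)
    have "expectation (g n) / real n \<le> (\<beta> * real n + real n * expectation (bad_excess \<beta> K)
     + real K * expectation (excess \<beta>)) / real n"
      using expectation_covering[OF K(1), of n \<beta>] by (intro divide_right_mono) auto
    also have "\<dots> = \<beta> + expectation (bad_excess \<beta> K) + real K * expectation (excess \<beta>) / real n"
      using elim by (simp add: field_simps)
    finally show ?case using elim by simp
  qed
qed

text \<open>If the bound failed at some \<open>\<beta> < \<gamma>\<close>, the dichotomy would put
  the lower rate below \<beta> almost everywhere, and \<open>expectation_eventually_less\<close>
  would contradict the hypothesis at a level between \<beta> and \<gamma>.\<close>

lemma lower_rate_ge:
  assumes "\<And>\<beta>. \<beta> < \<gamma> \<Longrightarrow> \<exists>\<^sub>F n in sequentially. \<beta> \<le> expectation (g n) / real n"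
  shows "AE x in N. ereal \<gamma> \<le> lower_rate x"
proof -
  have "AE x in N. ereal \<beta> \<le> lower_rate x" if "\<beta> < \<gamma>" for \<beta>
  proof (rule ccontr)
    assume "\<not> ?thesis"
    then have L: "AE x in N. lower_rate x < ereal \<beta>"
      using lower_rate_dichotomy by blast
    obtain \<beta>' where "\<beta> < \<beta>'" "\<beta>' < \<gamma>" using dense[OF \<open>\<beta> < \<gamma>\<close>] by blast
    from expectation_eventually_less[OF L this(1)] assms[OF this(2)] show False
      by (auto simp: frequently_def not_le)
  qed
  \<comment> \<open>Countably many levels tending to \<gamma> allow a single exceptional null
    set.\<close>
  then have "AE x in N. \<forall>k::nat. ereal (\<gamma> - 1 / real (Suc k)) \<le> lower_rate x"
    by (subst AE_all_countable) auto
  then show ?thesis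
  proof eventually_elim
    case (elim x)
    have "(\<lambda>k. \<gamma> - 1 / real (Suc k)) \<longlonglongrightarrow> \<gamma> - 0"
      by (intro tendsto_intros LIMSEQ_Suc lim_1_over_n)
    then have "(\<lambda>k. ereal (\<gamma> - 1 / real (Suc k))) \<longlonglongrightarrow> ereal \<gamma>" by simp
    then show ?case by (rule LIMSEQ_le_const2) (use elim in auto)
  qed
qed

end

section \<open>Birkhoff's ergodic theorem\<close>

context ergodic_map
begin

text \<open>Subadditivity holds with equality, for integrands of any sign.\<close>

lemma subadditive_process_sum:
  fixes h :: "'b \<Rightarrow> real"
  assumes "integrable N h"
  shows "subadditive_process N f (\<lambda>n x. \<Sum>k<n. h ((f ^^ k) x))"
proof unfold_locales
  show "integrable N (\<lambda>x. \<Sum>k<n. h ((f ^^ k) x))" for n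
    using integrable_iterate[OF assms] by auto
  show "(\<Sum>k<m + n. h ((f ^^ k) x)) \<le> (\<Sum>k<m. h ((f ^^ k) x)) + (\<Sum>k<n. h ((f ^^ k) ((f ^^ m) x)))"
    for m n x
  proof -
    have "(\<Sum>k=m..<m+n. h ((f ^^ k) x)) = (\<Sum>k<n. h ((f ^^ k) ((f ^^ m) x)))"
      using sum.shift_bounds_nat_ivl[of "\<lambda>k. h ((f ^^ k) x)" 0 m n]
      by (simp add: lessThan_atLeast0 funpow_add add.commute[of n m])
    then show ?thesis
      using sum.atLeastLessThan_concat[of 0 m "m + n" "\<lambda>k. h ((f ^^ k) x)"]
      by (simp add: lessThan_atLeast0)
  qed
qed simp

text \<open>The \<open>n\<close>-th sum has expectation \<open>n * expectation h\<close>, so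
  \<open>lower_rate_ge\<close> applies with the mean as threshold.\<close>

lemma birkhoff_lower:
  fixes h :: "'b \<Rightarrow> real"
  assumes h: "integrable N h"
  shows "AE x in N. ereal (expectation h) \<le> liminf (\<lambda>n. ereal ((\<Sum>k<n. h ((f ^^ k) x)) / real n))"
proof -
  interpret S: subadditive_process N f "\<lambda>n x. \<Sum>k<n. h ((f ^^ k) x)"
    using h by (rule subadditive_process_sum)
  have [measurable]: "h \<in> borel_measurable N" using h by auto
  have E: "expectation (\<lambda>x. \<Sum>k<n. h ((f ^^ k) x)) = real n * expectation h" for n
    by (simp add: integrable_iterate h expectation_iterate)
  have "AE x in N. ereal (expectation h) \<le> S.lower_rate x"
  proof (rule S.lower_rate_ge)
    fix \<beta> assume \<beta>: "\<beta> < expectation h"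
    have "\<forall>\<^sub>F n in sequentially. \<beta> \<le> expectation (\<lambda>x. \<Sum>k<n. h ((f ^^ k) x)) / real n"
      using eventually_gt_at_top[of 0] by eventually_elim (use \<beta> in \<open>simp add: E\<close>)
    then show "\<exists>\<^sub>F n in sequentially. \<beta> \<le> expectation (\<lambda>x. \<Sum>k<n. h ((f ^^ k) x)) / real n"
      by (intro eventually_frequently) auto
  qed
  then show ?thesis by (simp add: S.lower_rate_def)
qed

text \<open>The lower bound for \<open>- h\<close> is the upper bound for \<open>h\<close>.\<close>

theorem birkhoff:
  fixes h :: "'b \<Rightarrow> real"
  assumes h: "integrable N h"
  shows "AE x in N. (\<lambda>n. (\<Sum>k<n. h ((f ^^ k) x)) / real n) \<longlonglongrightarrow> expectation h"
proof -
  have "integrable N (\<lambda>x. - h x)" using h by simp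
  from birkhoff_lower[OF h] birkhoff_lower[OF this] show ?thesis
  proof eventually_elim
    case (elim x)
    show ?case
    proof (rule order_tendstoI)
      fix a assume "a < expectation h"
      then have "ereal a < liminf (\<lambda>n. ereal ((\<Sum>k<n. h ((f ^^ k) x)) / real n))"
        by (intro less_le_trans[OF _ elim(1)]) simp
      from less_LiminfD[OF this]
      show "\<forall>\<^sub>F n in sequentially. a < (\<Sum>k<n. h ((f ^^ k) x)) / real n" by simp
    next
      fix a assume "expectation h < a"
      then have "ereal (- a) < liminf (\<lambda>n. ereal ((\<Sum>k<n. - h ((f ^^ k) x)) / real n))"
        by (intro less_le_trans[OF _ elim(2)]) simp
      from less_LiminfD[OF this]
      show "\<forall>\<^sub>F n in sequentially. (\<Sum>k<n. h ((f ^^ k) x)) / real n < a"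
        by (simp add: sum_negf)
    qed
  qed
qed

text \<open>The terminal block is the difference of two Birkhoff sums whose averages share the same
  limit.\<close>

lemma terminal_sum_tendsto_0:
  fixes h :: "'b \<Rightarrow> real"
  assumes h: "integrable N h"
  shows "AE x in N. (\<lambda>n. (\<Sum>k=n-K..<n. h ((f ^^ k) x)) / real n) \<longlonglongrightarrow> 0"
  using birkhoff[OF h]
proof eventually_elim
  case (elim x)
  define S where "S n = (\<Sum>k<n. h ((f ^^ k) x))" for n
  have S: "(\<lambda>n. S n / real n) \<longlonglongrightarrow> expectation h"
    using elim by (simp add: S_def)
  have "(\<lambda>n. real K / real (n + K)) \<longlonglongrightarrow> 0"
    using LIMSEQ_ignore_initial_segment[OF lim_const_over_n[of "real K"], of K] by simp
  \<comment> \<open>The factor equals \<open>n / (n + K)\<close> and changes the denominator of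
    \<open>S n / n\<close>. Working at \<open>n + K\<close> avoids truncated subtraction; the shift
    is undone at the end.\<close>
  then have "(\<lambda>n. S (n + K) / real (n + K) - (S n / real n) * (1 - real K / real (n + K)))
      \<longlonglongrightarrow> expectation h - expectation h * (1 - 0)"
    by (intro tendsto_intros LIMSEQ_ignore_initial_segment S)
  moreover have "\<forall>\<^sub>F n in sequentially.
      S (n + K) / real (n + K) - (S n / real n) * (1 - real K / real (n + K))
      = (\<Sum>k=n+K-K..<n+K. h ((f ^^ k) x)) / real (n + K)"
    using eventually_gt_at_top[of 0]
  proof eventually_elim
    case (elim n)
    have "S (n + K) = S n + (\<Sum>k=n..<n+K. h ((f ^^ k) x))"
      using sum.atLeastLessThan_concat[of 0 n "n + K" "\<lambda>k. h ((f ^^ k) x)"]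
      by (simp add: S_def lessThan_atLeast0)
    moreover have "(S n / real n) * (1 - real K / real (n + K)) = S n / real (n + K)"
      using elim by (simp add: field_simps)
    ultimately show ?case by (simp add: add_divide_distrib)
  qed
  ultimately have "(\<lambda>n. (\<Sum>k=n+K-K..<n+K. h ((f ^^ k) x)) / real (n + K)) \<longlonglongrightarrow> 0"
    by (simp add: tendsto_cong del: add_diff_cancel_right')
  then show ?case
    by (rule LIMSEQ_offset[where k = K and f = "\<lambda>n. (\<Sum>k=n-K..<n. h ((f ^^ k) x)) / real n"])
qed

end

section \<open>Kingman's theorem for nonnegative processes\<close>

context subadditive_process
begin

text \<open>Pointwise counterpart of \<open>expectation_eventually_less\<close>: along almost every
  orbit Birkhoff's theorem averages the bad excess, and the terminal block is negligible.\<close>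

lemma eventually_less:
  assumes "AE x in N. lower_rate x < ereal \<beta>" "\<beta> < \<beta>'"
  shows "AE x in N. \<forall>\<^sub>F n in sequentially. g n x / real n < \<beta>'"
proof -
  obtain K where K: "1 \<le> K" "expectation (bad_excess \<beta> K) < \<beta>' - \<beta>"
    using small_bad_excess[OF assms(1), of "\<beta>' - \<beta>"] assms(2) by auto
  from birkhoff[OF integrable_bad_excess[of \<beta> K]]
    terminal_sum_tendsto_0[OF integrable_excess[of \<beta>], of K] AE_space
  show ?thesis
  proof eventually_elim
    case (elim x)
    let ?u = "\<lambda>n. \<beta> + (\<Sum>k<n. bad_excess \<beta> K ((f ^^ k) x)) / real n
      + (\<Sum>k=n-K..<n. excess \<beta> ((f ^^ k) x)) / real n"
    have "?u \<longlonglongrightarrow> \<beta> + expectation (bad_excess \<beta> K) + 0"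
      by (intro tendsto_intros elim)
    then have "\<forall>\<^sub>F n in sequentially. ?u n < \<beta>'"
      using K by (intro order_tendstoD) auto
    then show ?case using eventually_gt_at_top[of 0]
    proof eventually_elim
      case (elim n)
      have "g n x / real n \<le> (\<beta> * real n + (\<Sum>k<n. bad_excess \<beta> K ((f ^^ k) x))
          + (\<Sum>k=n-K..<n. excess \<beta> ((f ^^ k) x))) / real n"
        using covering_inequality[OF \<open>x \<in> space N\<close> K(1)] by (intro divide_right_mono) auto
      also have "\<dots> = ?u n"
        using elim(2) by (simp add: add_divide_distrib)
      finally show ?case using elim(1) by simp
    qed
  qed
qed

text \<open>Take \<gamma> to be the liminf of the normalized expectations.
  \<open>lower_rate_ge\<close> bounds the lower rate from below and Fatou's lemma from above; the
  covering estimates then yield both limits. Nonnegativity enters through the finiteness of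
  \<gamma>, Fatou's lemma and Scheffe's lemma.\<close>

theorem kingman_nonneg:
  assumes nonneg: "\<And>n x. x \<in> space N \<Longrightarrow> 0 \<le> g n x"
  obtains \<gamma> where "(\<lambda>n. expectation (g n) / real n) \<longlonglongrightarrow> \<gamma>"
    "AE x in N. (\<lambda>n. g n x / real n) \<longlonglongrightarrow> \<gamma>"
    "(\<lambda>n. \<integral>\<^sup>+ x. ennreal \<bar>g n x / real n - \<gamma>\<bar> \<partial>N) \<longlonglongrightarrow> 0"
proof -
  define e where "e n = expectation (g n) / real n" for n
  have e_nonneg: "0 \<le> e n" for n
    unfolding e_def by (intro divide_nonneg_nonneg integral_nonneg_AE) (auto simp: nonneg)
  have e_nn: "(\<integral>\<^sup>+ x. ennreal (g n x / real n) \<partial>N) = ennreal (e n)" for n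
    unfolding e_def using nonneg integrable_g
    by (subst nn_integral_eq_integral) (auto intro!: divide_nonneg_nonneg)
  have [measurable]: "excess 0 \<in> borel_measurable N"
    using integrable_excess by auto
  \<comment> \<open>The single-step bound at \<open>\<beta> = 0\<close> keeps the normalized
    expectations bounded, so their liminf is finite.\<close>
  have e_le: "e n \<le> expectation (excess 0)" if "0 < n" for n
  proof -
    have "expectation (g n) \<le> expectation (\<lambda>x. \<Sum>k<n. excess 0 ((f ^^ k) x))"
      using le_sum_excess[of _ n 0]
      by (intro integral_mono integrable_g Bochner_Integration.integrable_sum
          integrable_iterate[OF integrable_excess]) auto
    also have "\<dots> = real n * expectation (excess 0)"
      by (simp add: integrable_iterate[OF integrable_excess] expectation_iterate)
    finally show ?thesis using that by (simp add: e_def field_simps)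
  qed
  have "0 \<le> liminf (\<lambda>n. ereal (e n))"
    by (rule Liminf_bounded) (simp add: e_nonneg)
  moreover have "liminf (\<lambda>n. ereal (e n)) \<le> ereal (expectation (excess 0))"
    using e_le by (intro Liminf_le eventually_mono[OF eventually_gt_at_top[of 0]]) auto
  ultimately obtain \<gamma> where \<gamma>: "liminf (\<lambda>n. ereal (e n)) = ereal \<gamma>"
    by (cases "liminf (\<lambda>n. ereal (e n))") auto
  have above: "\<forall>\<^sub>F n in sequentially. \<beta> < e n" if "\<beta> < \<gamma>" for \<beta>
    using less_LiminfD[of "ereal \<beta>" sequentially "\<lambda>n. ereal (e n)"] that \<gamma> by simp
  have ge: "AE x in N. ereal \<gamma> \<le> lower_rate x"
  proof (rule lower_rate_ge)
    fix \<beta> assume "\<beta> < \<gamma>"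
    from above[OF this] have "\<forall>\<^sub>F n in sequentially. \<beta> \<le> expectation (g n) / real n"
      by eventually_elim (simp add: e_def)
    then show "\<exists>\<^sub>F n in sequentially. \<beta> \<le> expectation (g n) / real n"
      by (intro eventually_frequently) auto
  qed
  have less: "AE x in N. lower_rate x < ereal \<beta>" if \<beta>: "\<gamma> < \<beta>" for \<beta>
  proof (rule ccontr)
    assume "\<not> ?thesis"
    then have L: "AE x in N. ereal \<beta> \<le> lower_rate x"
      using lower_rate_dichotomy by blast
    \<comment> \<open>The gap from \<beta> down to \<open>b\<close> makes the pointwise liminf bound
      strict; the gap from \<open>b\<close> down to \<open>a\<close> does the same for the
      expectations after Fatou's lemma.\<close>
    obtain b where b: "\<gamma> < b" "b < \<beta>" using dense[OF \<beta>] by blast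
    obtain a where a: "\<gamma> < a" "a < b" using dense[OF b(1)] by blast
    have "0 \<le> \<gamma>" using \<open>0 \<le> liminf _\<close> \<gamma> by simp
    have "ennreal b = (\<integral>\<^sup>+ x. ennreal b \<partial>N)"
      by (simp add: emeasure_space_1)
    also have "\<dots> \<le> (\<integral>\<^sup>+ x. liminf (\<lambda>n. ennreal (g n x / real n)) \<partial>N)"
    proof (rule nn_integral_mono_AE, use L in eventually_elim)
      case (elim x)
      have "ereal b < liminf (\<lambda>n. ereal (g n x / real n))"
        using b elim unfolding lower_rate_def by (intro less_le_trans[OF _ elim[unfolded lower_rate_def]]) simp
      from less_LiminfD[OF this] show ?case
        by (intro Liminf_bounded) (auto elim!: eventually_mono intro: ennreal_leI)
    qed
    also have "\<dots> \<le> liminf (\<lambda>n. \<integral>\<^sup>+ x. ennreal (g n x / real n) \<partial>N)"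
      by (rule nn_integral_liminf) measurable
    finally have "ennreal b \<le> liminf (\<lambda>n. ennreal (e n))"
      by (simp add: e_nn)
    moreover have "ennreal a < ennreal b"
      using a \<open>0 \<le> \<gamma>\<close> by (simp add: ennreal_less_iff)
    ultimately have "\<forall>\<^sub>F n in sequentially. ennreal a < ennreal (e n)"
      by (intro less_LiminfD) (rule less_le_trans)
    then have "\<forall>\<^sub>F n in sequentially. ereal a \<le> ereal (e n)"
      by eventually_elim (use a \<open>0 \<le> \<gamma>\<close> in \<open>auto simp: ennreal_less_iff\<close>)
    then have "ereal a \<le> ereal \<gamma>"
      unfolding \<gamma>[symmetric] by (rule Liminf_bounded)
    with a show False by simp
  qed
  have e_lim: "e \<longlonglongrightarrow> \<gamma>"
  proof (rule order_tendstoI)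
    fix a assume "\<gamma> < a"
    then obtain b where "\<gamma> < b" "b < a" using dense by blast
    then show "\<forall>\<^sub>F n in sequentially. e n < a"
      unfolding e_def using expectation_eventually_less less by blast
  qed (rule above)
  have lt: "AE x in N. \<forall>\<^sub>F n in sequentially. g n x / real n < a" if "\<gamma> < a" for a
  proof -
    obtain b where "\<gamma> < b" "b < a" using dense[OF \<open>\<gamma> < a\<close>] by blast
    with eventually_less less show ?thesis by blast
  qed
  have "AE x in N. \<forall>k::nat. \<forall>\<^sub>F n in sequentially. g n x / real n < \<gamma> + 1 / real (Suc k)"
    by (subst AE_all_countable) (auto intro!: lt simp del: of_nat_Suc)
  with ge have ae: "AE x in N. (\<lambda>n. g n x / real n) \<longlonglongrightarrow> \<gamma>"
  proof eventually_elim
    case (elim x)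
    show ?case
    proof (rule order_tendstoI)
      fix a assume "a < \<gamma>"
      then have "ereal a < liminf (\<lambda>n. ereal (g n x / real n))"
        by (intro less_le_trans[OF _ elim(1)[unfolded lower_rate_def]]) simp
      from less_LiminfD[OF this]
      show "\<forall>\<^sub>F n in sequentially. a < g n x / real n" by simp
    next
      fix a assume "\<gamma> < a"
      then obtain k where "1 / real (Suc k) < a - \<gamma>"
        using reals_Archimedean[of "a - \<gamma>"] by (auto simp: inverse_eq_divide)
      then have k: "\<gamma> + 1 / real (Suc k) < a" by simp
      from elim(2) have "\<forall>\<^sub>F n in sequentially. g n x / real n < \<gamma> + 1 / real (Suc k)" ..
      then show "\<forall>\<^sub>F n in sequentially. g n x / real n < a"
        by eventually_elim (use k in linarith)
    qed
  qed
  have "0 \<le> \<gamma>"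
    using \<open>0 \<le> liminf _\<close> \<gamma> by simp
  \<comment> \<open>By nonnegativity the mean norm of \<open>g n / n\<close> is \<open>e n\<close>,
    which tends to the norm of the constant \<gamma>; with almost sure convergence this is what
    Scheffe's lemma asks for.\<close>
  have "(\<lambda>n. \<integral>\<^sup>+ x. norm (g n x / real n - \<gamma>) \<partial>N) \<longlonglongrightarrow> 0"
  proof (rule Scheffe_lemma1)
    have "(\<integral>\<^sup>+ x. ennreal (norm (g n x / real n)) \<partial>N) = ennreal (e n)" for n
      unfolding e_nn[symmetric] by (intro nn_integral_cong) (simp add: nonneg)
    moreover have "limsup (\<lambda>n. ennreal (e n)) = ennreal \<gamma>"
      using e_lim by (intro lim_imp_Limsup) (auto intro!: tendsto_ennrealI)
    ultimately show "limsup (\<lambda>n. \<integral>\<^sup>+ x. ennreal (norm (g n x / real n)) \<partial>N)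
        \<le> (\<integral>\<^sup>+ x. ennreal (norm \<gamma>) \<partial>N)"
      using \<open>0 \<le> \<gamma>\<close> by (simp add: emeasure_space_1)
  qed (use integrable_g ae in auto)
  with e_lim ae show ?thesis
    by (intro that[of \<gamma>]) (auto simp: e_def[abs_def])
qed

end

section \<open>Random pseudometrics with ergodic translations: limits along directions\<close>

locale ergodic_pseudometric = prob_space M for M :: "'w measure" +
  fixes T :: "'w \<Rightarrow> 'a::real_vector \<Rightarrow> 'a \<Rightarrow> real"
  assumes measurable_T [measurable]: "T \<in> M \<rightarrow>\<^sub>M pseudometric_space"
    and translation_ergodic: "translation_ergodic M T"
    and integrable_0: "integrable M (\<lambda>\<omega>. T \<omega> 0 x)"
begin

lemma pseudometric_T: "\<omega> \<in> space M \<Longrightarrow> pseudometric (T \<omega>)"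
  using measurable_space[OF measurable_T] by simp

lemma measurable_T_eval [measurable]: "(\<lambda>\<omega>. T \<omega> x y) \<in> borel_measurable M"
  using measurable_compose[OF measurable_T measurable_eval] .

lemma sets_law [measurable_cong]: "sets (law M T) = sets pseudometric_space"
  by (simp add: law_def)

text \<open>Expectation and integrability of an evaluation depend only on the law. Stated for
  arbitrary \<open>g\<close> to serve translations and orthogonal maps alike.\<close>

lemma integral_pull_back:
  assumes "invariant_under (pull_back g) (law M T)"
  shows "expectation (\<lambda>\<omega>. T \<omega> (g x) (g y)) = expectation (\<lambda>\<omega>. T \<omega> x y)"
    and "integrable M (\<lambda>\<omega>. T \<omega> (g x) (g y)) \<longleftrightarrow> integrable M (\<lambda>\<omega>. T \<omega> x y)"
proof -
  have meas: "(\<lambda>\<omega>. pull_back g (T \<omega>)) \<in> M \<rightarrow>\<^sub>M pseudometric_space"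
    by measurable
  have inv: "distr M pseudometric_space (\<lambda>\<omega>. pull_back g (T \<omega>)) = distr M pseudometric_space T"
  proof -
    have "distr M pseudometric_space (\<lambda>\<omega>. pull_back g (T \<omega>)) = distr (law M T) pseudometric_space (pull_back g)"
      by (simp add: law_def distr_distr comp_def)
    \<comment> \<open>Taking \<open>law M T\<close> as the target changes nothing, since only the
      measurable sets of the target matter.\<close>
    also have "\<dots> = distr (law M T) (law M T) (pull_back g)"
      by (rule distr_cong) (auto simp: sets_law)
    finally show ?thesis using assms by (simp add: invariant_under_def law_def)
  qed
  have "expectation (\<lambda>\<omega>. T \<omega> (g x) (g y))
      = (\<integral>S. S x y \<partial>distr M pseudometric_space (\<lambda>\<omega>. pull_back g (T \<omega>)))"
    unfolding integral_distr[OF meas measurable_eval] by (simp add: pull_back_def)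
  also have "\<dots> = expectation (\<lambda>\<omega>. T \<omega> x y)"
    unfolding inv by (subst integral_distr) auto
  finally show "expectation (\<lambda>\<omega>. T \<omega> (g x) (g y)) = expectation (\<lambda>\<omega>. T \<omega> x y)" .
  have "integrable M (\<lambda>\<omega>. T \<omega> (g x) (g y))
      \<longleftrightarrow> integrable (distr M pseudometric_space (\<lambda>\<omega>. pull_back g (T \<omega>))) (\<lambda>S. S x y)"
    unfolding integrable_distr_eq[OF meas measurable_eval] by (simp add: pull_back_def)
  also have "\<dots> \<longleftrightarrow> integrable M (\<lambda>\<omega>. T \<omega> x y)"
    unfolding inv by (subst integrable_distr_eq) auto
  finally show "integrable M (\<lambda>\<omega>. T \<omega> (g x) (g y)) \<longleftrightarrow> integrable M (\<lambda>\<omega>. T \<omega> x y)" .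
qed

lemma invariant_translate: "v \<noteq> 0 \<Longrightarrow> invariant_under (pull_back (\<lambda>x. v + x)) (law M T)"
  using translation_ergodic by (auto simp: translation_ergodic_def ergodic_for_def translate_def)

text \<open>Translate by \<open>x\<close>; the trivial case \<open>x = 0\<close> is split off
  because ergodicity concerns nonzero vectors only.\<close>

lemma expectation_eq: "expectation (\<lambda>\<omega>. T \<omega> x y) = expectation (\<lambda>\<omega>. T \<omega> 0 (y - x))"
  using integral_pull_back(1)[OF invariant_translate, of x 0 "y - x"] by (cases "x = 0") auto

lemma integrable_T: "integrable M (\<lambda>\<omega>. T \<omega> x y)"
  using integral_pull_back(2)[OF invariant_translate, of x 0 "y - x"] integrable_0
  by (cases "x = 0") auto

text \<open>Translations act on pseudometrics rather than on the sample space, so the process lives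
  under the law of \<open>T\<close>. Subadditivity is the triangle inequality through
  \<open>m v\<close>.\<close>

lemma subadditive_process_law:
  assumes "v \<noteq> 0"
  shows "subadditive_process (law M T) (translate v) (\<lambda>n S. S 0 (real n *\<^sub>R v))"
proof -
  have pow: "(translate v ^^ m) S x y = S (real m *\<^sub>R v + x) (real m *\<^sub>R v + y)" for m S x y
    by (induction m arbitrary: x y)
      (auto simp: translate_def pull_back_def algebra_simps)
  interpret L: prob_space "law M T"
    unfolding law_def by (rule prob_space_distr) simp
  show ?thesis
  proof unfold_locales
    show "ergodic_for (translate v) (law M T)"
      using translation_ergodic assms by (simp add: translation_ergodic_def)
    show "integrable (law M T) (\<lambda>S. S 0 (real n *\<^sub>R v))" for n
      unfolding law_def by (subst integrable_distr_eq) (auto simp: integrable_0)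
    fix S assume "S \<in> space (law M T)"
    then have S: "pseudometric S" by (simp add: law_def)
    show "S 0 (real 0 *\<^sub>R v) = 0" using S by (simp add: pseudometric_def)
    show "S 0 (real (m + n) *\<^sub>R v)
        \<le> S 0 (real m *\<^sub>R v) + (translate v ^^ m) S 0 (real n *\<^sub>R v)" for m n
      using S unfolding pow by (simp add: pseudometric_def scaleR_left_distrib)
  qed
qed

lemma rate_exists:
  "\<exists>\<gamma>. (\<lambda>n. expectation (\<lambda>\<omega>. T \<omega> 0 (real n *\<^sub>R v)) / real n) \<longlonglongrightarrow> \<gamma> \<and>
    (AE \<omega> in M. (\<lambda>n. T \<omega> 0 (real n *\<^sub>R v) / real n) \<longlonglongrightarrow> \<gamma>) \<and>
    (\<lambda>n. \<integral>\<^sup>+ \<omega>. ennreal \<bar>T \<omega> 0 (real n *\<^sub>R v) / real n - \<gamma>\<bar> \<partial>M) \<longlonglongrightarrow> 0"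
proof (cases "v = 0")
  case True
  \<comment> \<open>Ergodicity says nothing for \<open>v = 0\<close>, but all distances involved
    vanish and the limit is 0.\<close>
  have [simp]: "\<omega> \<in> space M \<Longrightarrow> T \<omega> 0 0 = 0" for \<omega>
    using pseudometric_T by (simp add: pseudometric_def)
  have "expectation (\<lambda>\<omega>. T \<omega> 0 0) = 0" "(\<integral>\<^sup>+ \<omega>. ennreal \<bar>T \<omega> 0 0 / real n\<bar> \<partial>M) = 0" for n
    by (simp_all cong: Bochner_Integration.integral_cong nn_integral_cong)
  then show ?thesis using True by (intro exI[of _ 0]) simp
next
  case False
  interpret S: subadditive_process "law M T" "translate v" "\<lambda>n S. S 0 (real n *\<^sub>R v)"
    using False by (rule subadditive_process_law)
  obtain \<gamma> where
      1: "(\<lambda>n. S.expectation (\<lambda>S. S 0 (real n *\<^sub>R v)) / real n) \<longlonglongrightarrow> \<gamma>"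
    and 2: "AE S in law M T. (\<lambda>n. S 0 (real n *\<^sub>R v) / real n) \<longlonglongrightarrow> \<gamma>"
    and 3: "(\<lambda>n. \<integral>\<^sup>+ S. ennreal \<bar>S 0 (real n *\<^sub>R v) / real n - \<gamma>\<bar> \<partial>law M T) \<longlonglongrightarrow> 0"
    by (rule S.kingman_nonneg) (auto simp: law_def pseudometric_def)
  \<comment> \<open>The three limits depend on \<open>T\<close> only through its law and so transfer
    back to the sample space.\<close>
  have "S.expectation (\<lambda>S. S 0 (real n *\<^sub>R v)) = expectation (\<lambda>\<omega>. T \<omega> 0 (real n *\<^sub>R v))" for n
    unfolding law_def by (subst integral_distr) auto
  moreover have "(\<integral>\<^sup>+ S. ennreal \<bar>S 0 (real n *\<^sub>R v) / real n - \<gamma>\<bar> \<partial>law M T)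
      = (\<integral>\<^sup>+ \<omega>. ennreal \<bar>T \<omega> 0 (real n *\<^sub>R v) / real n - \<gamma>\<bar> \<partial>M)" for n
    unfolding law_def by (subst nn_integral_distr) auto
  ultimately show ?thesis
    using 1 3 AE_distrD[OF measurable_T 2[unfolded law_def]] by (intro exI[of _ \<gamma>]) simp
qed

section \<open>The limit as a rational semi-norm\<close>

definition rate :: "'a \<Rightarrow> real" where
  "rate v = lim (\<lambda>n. expectation (\<lambda>\<omega>. T \<omega> 0 (real n *\<^sub>R v)) / real n)"

text \<open>The expectations determine their limit, so the constant of \<open>rate_exists\<close> is
  \<open>rate v\<close> in all three modes of convergence.\<close>

lemma expectation_tendsto_rate:
    "(\<lambda>n. expectation (\<lambda>\<omega>. T \<omega> 0 (real n *\<^sub>R v)) / real n) \<longlonglongrightarrow> rate v"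
  and AE_tendsto_rate:
    "AE \<omega> in M. (\<lambda>n. T \<omega> 0 (real n *\<^sub>R v) / real n) \<longlonglongrightarrow> rate v"
  and L1_tendsto_rate:
    "(\<lambda>n. \<integral>\<^sup>+ \<omega>. ennreal \<bar>T \<omega> 0 (real n *\<^sub>R v) / real n - rate v\<bar> \<partial>M) \<longlonglongrightarrow> 0"
proof -
  obtain \<gamma> where \<gamma>:
      "(\<lambda>n. expectation (\<lambda>\<omega>. T \<omega> 0 (real n *\<^sub>R v)) / real n) \<longlonglongrightarrow> \<gamma>"
      "AE \<omega> in M. (\<lambda>n. T \<omega> 0 (real n *\<^sub>R v) / real n) \<longlonglongrightarrow> \<gamma>"
      "(\<lambda>n. \<integral>\<^sup>+ \<omega>. ennreal \<bar>T \<omega> 0 (real n *\<^sub>R v) / real n - \<gamma>\<bar> \<partial>M) \<longlonglongrightarrow> 0"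
    using rate_exists by blast
  moreover have "rate v = \<gamma>"
    unfolding rate_def using \<gamma>(1) by (rule limI)
  ultimately show
    "(\<lambda>n. expectation (\<lambda>\<omega>. T \<omega> 0 (real n *\<^sub>R v)) / real n) \<longlonglongrightarrow> rate v"
    "AE \<omega> in M. (\<lambda>n. T \<omega> 0 (real n *\<^sub>R v) / real n) \<longlonglongrightarrow> rate v"
    "(\<lambda>n. \<integral>\<^sup>+ \<omega>. ennreal \<bar>T \<omega> 0 (real n *\<^sub>R v) / real n - rate v\<bar> \<partial>M) \<longlonglongrightarrow> 0"
    by simp_all
qed

text \<open>Means suffice to compare rates, so a symmetry of the law becomes a symmetry of
  \<open>rate\<close>.\<close>

lemma rate_eqI:
  assumes "\<And>n. expectation (\<lambda>\<omega>. T \<omega> 0 (real n *\<^sub>R v)) = expectation (\<lambda>\<omega>. T \<omega> 0 (real n *\<^sub>R w))"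
  shows "rate v = rate w"
  by (simp add: rate_def assms)

text \<open>Translation by \<open>n v\<close> moves the pair \<open>(0, - n v)\<close> to
  \<open>(n v, 0)\<close>; symmetry of \<open>T\<close> does the rest.\<close>

lemma rate_minus: "rate (- v) = rate v"
proof (rule rate_eqI)
  fix n
  have "expectation (\<lambda>\<omega>. T \<omega> 0 (real n *\<^sub>R - v)) = expectation (\<lambda>\<omega>. T \<omega> (real n *\<^sub>R v) 0)"
    using expectation_eq[of "real n *\<^sub>R v" 0] by simp
  also have "\<dots> = expectation (\<lambda>\<omega>. T \<omega> 0 (real n *\<^sub>R v))"
    using pseudometric_T by (intro Bochner_Integration.integral_cong) (auto simp: pseudometric_def)
  finally show "expectation (\<lambda>\<omega>. T \<omega> 0 (real n *\<^sub>R - v)) = expectation (\<lambda>\<omega>. T \<omega> 0 (real n *\<^sub>R v))" .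
qed

lemma rate_nonneg: "0 \<le> rate v"
proof (rule LIMSEQ_le_const[OF expectation_tendsto_rate])
  show "\<exists>N. \<forall>n\<ge>N. 0 \<le> expectation (\<lambda>\<omega>. T \<omega> 0 (real n *\<^sub>R v)) / real n"
    using pseudometric_T
    by (auto intro!: divide_nonneg_nonneg integral_nonneg_AE simp: pseudometric_def)
qed

text \<open>Triangle inequality through \<open>n v\<close>, where stationarity brings the second leg
  back to the origin.\<close>

lemma rate_triangle: "rate (v + w) \<le> rate v + rate w"
proof (rule LIMSEQ_le[OF expectation_tendsto_rate tendsto_add[OF expectation_tendsto_rate expectation_tendsto_rate]])
  have "expectation (\<lambda>\<omega>. T \<omega> 0 (real n *\<^sub>R (v + w))) / real n
    \<le> expectation (\<lambda>\<omega>. T \<omega> 0 (real n *\<^sub>R v)) / real n + expectation (\<lambda>\<omega>. T \<omega> 0 (real n *\<^sub>R w)) / real n" for n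
  proof -
    have "expectation (\<lambda>\<omega>. T \<omega> 0 (real n *\<^sub>R (v + w)))
      \<le> expectation (\<lambda>\<omega>. T \<omega> 0 (real n *\<^sub>R v) + T \<omega> (real n *\<^sub>R v) (real n *\<^sub>R (v + w)))"
      using pseudometric_T integrable_T by (intro integral_mono) (auto simp: pseudometric_def)
    also have "\<dots> = expectation (\<lambda>\<omega>. T \<omega> 0 (real n *\<^sub>R v)) + expectation (\<lambda>\<omega>. T \<omega> 0 (real n *\<^sub>R w))"
      using expectation_eq[of "real n *\<^sub>R v" "real n *\<^sub>R (v + w)"]
      by (simp add: integrable_T scaleR_right_distrib)
    finally show ?thesis
      by (simp add: divide_right_mono flip: add_divide_distrib)
  qed
  then show "\<exists>N. \<forall>n\<ge>N. expectation (\<lambda>\<omega>. T \<omega> 0 (real n *\<^sub>R (v + w))) / real n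
    \<le> expectation (\<lambda>\<omega>. T \<omega> 0 (real n *\<^sub>R v)) / real n + expectation (\<lambda>\<omega>. T \<omega> 0 (real n *\<^sub>R w)) / real n"
    by blast
qed

text \<open>The multiples of \<open>k\<close> give a subsequence of the means along
  \<open>v\<close>, with the same limit.\<close>

lemma rate_scale_nat:
  assumes "0 < k"
  shows "rate (real k *\<^sub>R v) = real k * rate v"
proof (rule LIMSEQ_unique[OF expectation_tendsto_rate])
  have "strict_mono (\<lambda>n. n * k)" using assms by (simp add: strict_mono_def)
  from LIMSEQ_subseq_LIMSEQ[OF expectation_tendsto_rate this]
  have "(\<lambda>n. real k * (expectation (\<lambda>\<omega>. T \<omega> 0 (real (n * k) *\<^sub>R v)) / real (n * k)))
      \<longlonglongrightarrow> real k * rate v"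
    by (intro tendsto_mult_left) (simp add: comp_def)
  then show "(\<lambda>n. expectation (\<lambda>\<omega>. T \<omega> 0 (real n *\<^sub>R real k *\<^sub>R v)) / real n) \<longlonglongrightarrow> real k * rate v"
    using assms by simp
qed

lemma rate_scale_int: "rate (real_of_int a *\<^sub>R v) = \<bar>real_of_int a\<bar> * rate v"
proof -
  \<comment> \<open>This forces \<open>rate 0 = 0\<close>, which settles
    \<open>a = 0\<close>.\<close>
  have "rate 0 = 2 * rate 0" using rate_scale_nat[of 2 0] by simp
  moreover have "rate (real_of_int a *\<^sub>R v) = real (nat a) * rate v" if "0 < a"
    using rate_scale_nat[of "nat a" v] that by simp
  moreover have "rate (real_of_int a *\<^sub>R v) = real (nat (- a)) * rate v" if "a < 0"
    using rate_scale_nat[of "nat (- a)" v] rate_minus[of "real_of_int a *\<^sub>R v"] that by simp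
  ultimately show ?thesis
    by (cases a "0 :: int" rule: linorder_cases) auto
qed

lemma rat_seminorm_rate: "rat_seminorm rate"
  unfolding rat_seminorm_def
proof (intro conjI allI rate_nonneg rate_triangle)
  fix q :: rat and x
  obtain a b where q: "q = Fract a b" "0 < b" by (cases q) auto
  \<comment> \<open>Clear the denominator: \<open>b * q\<close> is the integer \<open>a\<close>, and
    the positive \<open>b\<close> is cancelled at the end.\<close>
  have "real_of_int b * rate (of_rat q *\<^sub>R x) = rate (real_of_int b *\<^sub>R of_rat q *\<^sub>R x)"
    using q(2) by (simp only: rate_scale_int)
  also have "\<dots> = rate (real_of_int a *\<^sub>R x)"
    using q by (simp add: of_rat_rat)
  also have "\<dots> = real_of_int b * (\<bar>of_rat q\<bar> * rate x)"
    using q by (simp add: rate_scale_int of_rat_rat)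
  finally show "rate (of_rat q *\<^sub>R x) = \<bar>of_rat q\<bar> * rate x"
    using q(2) by simp
qed

end

section \<open>Assembly of the limit theorem, with the isotropic case\<close>

theorem theorem2p4:
  fixes M :: "'w measure" and T :: "'w \<Rightarrow> real ^ 'd \<Rightarrow> real ^ 'd \<Rightarrow> real"
  assumes "prob_space M"
    and "T \<in> M \<rightarrow>\<^sub>M pseudometric_space"
    and "translation_ergodic M T"
    and "\<And>x. integrable M (\<lambda>\<omega>. T \<omega> 0 x)"
  shows "\<exists>\<mu> :: real ^ 'd \<Rightarrow> real. rat_seminorm \<mu> \<and>
    (\<forall>v. (AE \<omega> in M. (\<lambda>n. T \<omega> 0 (real n *\<^sub>R v) / real n) \<longlonglongrightarrow> \<mu> v) \<and>
         (\<lambda>n. \<integral>\<^sup>+ \<omega>. ennreal \<bar>T \<omega> 0 (real n *\<^sub>R v) / real n - \<mu> v\<bar> \<partial>M) \<longlonglongrightarrow> 0) \<and>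
    (isotropic M T \<longrightarrow> \<mu> constant_on sphere 0 1)"
proof -
  interpret ergodic_pseudometric M T
    using assms by (simp add: ergodic_pseudometric_def ergodic_pseudometric_axioms_def)
  have "rate constant_on sphere 0 1" if "isotropic M T"
  proof -
    \<comment> \<open>Orthogonal maps act transitively on the unit sphere and are linear, so
      invariance carries the means along \<open>x\<close> to those along \<open>y\<close>.\<close>
    have rate_eq: "rate x = rate y" if xy: "norm x = 1" "norm y = 1" for x y
    proof -
      obtain g where g: "orthogonal_transformation g" "g x = y"
        using orthogonal_transformation_exists_1[OF xy] .
      then have lin: "linear g" by (simp add: orthogonal_transformation_def)
      have inv: "invariant_under (pull_back g) (law M T)"
        using \<open>isotropic M T\<close> g by (simp add: isotropic_def)
      have "expectation (\<lambda>\<omega>. T \<omega> 0 (real n *\<^sub>R x)) = expectation (\<lambda>\<omega>. T \<omega> 0 (real n *\<^sub>R y))" for n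
        using integral_pull_back(1)[OF inv, of 0 "real n *\<^sub>R x"]
        by (simp add: linear_0[OF lin] linear_cmul[OF lin] g)
      then show ?thesis by (rule rate_eqI)
    qed
    show ?thesis
      unfolding constant_on_def
    proof (intro exI ballI)
      fix x :: "real ^ 'd" assume "x \<in> sphere 0 1"
      \<comment> \<open>Any unit vector can serve as reference; this is the coordinate vector of an
        unspecified index.\<close>
      then show "rate x = rate (axis undefined 1)"
        by (intro rate_eq) (simp_all add: norm_axis_1)
    qed
  qed
  with rat_seminorm_rate AE_tendsto_rate L1_tendsto_rate show ?thesis
    by blast
qed

end
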